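(* Let $(p_n(x))_{n\ge 0}$ and $(q_n(x))_{n\ge 0}$ be two Appell sequences. Then for every integer $n\ge 0$, $$\sum_{k=0}^n (-1)^k \binom{n}{k}\, p_{n-k}(x)\,q_{k}(x) = c_n,$$ where $\{c_n\}$ are constants independent of $x$. Moreover, if $p_n(x)=q_n(x)$ for all $n$, then $c_n=0$ for every odd positive integer $n$.
   Context: An Appell sequence is a sequence of polynomials $(p_n(x))_{n\ge 0}$ (with real or complex coefficients) such that $p_0(x)=1$ and $p_n'(x)=n\,p_{n-1}(x)$ for all $n\ge 1$. *)

theory Defs
  imports Complex_Main "HOL-Computational_Algebra.Polynomial"
begin

(* Coefficients are real or complex: both types are instances of real_normed_field, and up to
   isomorphism there are no others (Gelfand-Mazur). *)
definition appell_sequence :: "(nat \<Rightarrow> 'a::real_normed_field poly) \<Rightarrow> bool" where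
  "appell_sequence p \<longleftrightarrow>
     p 0 = 1 \<and> (\<forall>n\<ge>1. pderiv (p n) = smult (of_nat n) (p (n - 1)))"

end

theory Submission
  imports Defs
begin

text \<open>
  Differentiating the alternating convolution of two Appell sequences in degree \<open>n = m + 1\<close>
  produces two sums, one from each factor of the products.  By the absorption identities
  \<open>(n - k) (n choose k) = n (m choose k)\<close> and \<open>(k + 1) (n choose (k + 1)) = n (m choose k)\<close>, both
  are, up to sign, \<open>n\<close> times the alternating convolution in degree \<open>m\<close>; the shift of \<open>k\<close> in the
  second one flips the sign, so they cancel (lemma \<open>pderiv_alternating_convolution\<close>).  In
  characteristic zero a polynomial with vanishing derivative is constant.

  When the two sequences coincide, the reflection \<open>k \<mapsto> n - k\<close> multiplies the sum by
  \<open>(-1) ^ n\<close>; for odd \<open>n\<close> the sum is its own negative, hence zero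
  (lemma \<open>alternating_convolution_self_odd\<close>).
\<close>

definition alternating_convolution ::
    "(nat \<Rightarrow> 'a::comm_ring_1) \<Rightarrow> (nat \<Rightarrow> 'a) \<Rightarrow> nat \<Rightarrow> 'a" where
  "alternating_convolution a b n = (\<Sum>k=0..n. (-1) ^ k * of_nat (n choose k) * a (n - k) * b k)"

lemma poly_alternating_convolution:
  "poly (alternating_convolution p q n) x =
     (\<Sum>k=0..n. (-1) ^ k * of_nat (n choose k) * poly (p (n - k)) x * poly (q k) x)"
  by (simp add: alternating_convolution_def poly_sum)

text \<open>
  At index \<open>0\<close>, where \<open>n - 1\<close> is truncated, both sides vanish.  So the product rule below
  treats all summands uniformly.
\<close>

lemma pderiv_appell:
  assumes "appell_sequence p"
  shows "pderiv (p n) = of_nat n * p (n - 1)"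
proof (cases n)
  case 0
  then show ?thesis using assms by (simp add: appell_sequence_def)
next
  case (Suc m)
  then have "pderiv (p n) = smult (of_nat n) (p (n - 1))"
    using assms by (simp add: appell_sequence_def)
  then show ?thesis by (simp add: of_nat_poly)
qed

lemma pderiv_alternating_convolution:
  fixes p q :: "nat \<Rightarrow> 'a::real_normed_field poly"
  assumes p: "appell_sequence p" and q: "appell_sequence q"
  shows "pderiv (alternating_convolution p q n) = 0"
proof (cases n)
  case 0
  then show ?thesis
    using p q by (simp add: alternating_convolution_def appell_sequence_def)
next
  case (Suc m)
  \<comment> \<open>\<open>F\<close> and \<open>G\<close> are the contributions of \<open>p'\<close> and \<open>q'\<close> to the product rule.
    The factors \<open>n - k\<close> and \<open>k\<close> remove \<open>F n\<close> and \<open>G 0\<close>, so the rest pairs as \<open>F k\<close>, \<open>G (Suc k)\<close>.\<close>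
  define F where "F = (\<lambda>k. (-1) ^ k * of_nat ((n choose k) * (n - k)) * p (n - k - 1) * q k)"
  define G where "G = (\<lambda>k. (-1) ^ k * of_nat ((n choose k) * k) * p (n - k) * q (k - 1))"
  have const: "pderiv ((-1) ^ k :: 'a poly) = 0" for k
    by (cases "even k") (simp_all add: pderiv_minus)
  have "pderiv (alternating_convolution p q n) = (\<Sum>k=0..n. F k + G k)"
    unfolding alternating_convolution_def higher_pderiv_sum[of 1, simplified]
    by (intro sum.cong refl)
       (simp add: F_def G_def pderiv_mult const pderiv_appell[OF p] pderiv_appell[OF q]
                  algebra_simps)
  also have "\<dots> = (\<Sum>k=0..n. F k) + (\<Sum>k=0..n. G k)"
    by (rule sum.distrib)
  also have "(\<Sum>k=0..n. F k) = (\<Sum>k=0..m. F k)"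
    by (simp add: Suc F_def)
  also have "(\<Sum>k=0..n. G k) = (\<Sum>k=0..m. G (Suc k))"
    unfolding Suc sum.atLeast0_atMost_Suc_shift by (simp add: G_def)
  also have "\<dots> = (\<Sum>k=0..m. - F k)"
  proof (rule sum.cong)
    fix k assume "k \<in> {0..m}"
    \<comment> \<open>Both products equal \<open>n * (m choose k)\<close>.\<close>
    have "(n choose Suc k) * Suc k = (n choose k) * (n - k)"
      using binomial_absorb_comp[of n k] binomial_absorption[of k n]
      by (simp only: mult.commute)
    then show "G (Suc k) = - F k"
      unfolding F_def G_def by (simp only: diff_Suc_1 power_Suc) simp
  qed simp
  finally show ?thesis by (simp add: sum_negf)
qed

lemma alternating_convolution_self_odd:
  fixes a :: "nat \<Rightarrow> 'a::{idom,ring_char_0}"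
  assumes "odd n"
  shows "alternating_convolution a a n = 0"
proof -
  have "alternating_convolution a a n =
      (\<Sum>k=0..n. (-1) ^ (n - k) * of_nat (n choose (n - k)) * a (n - (n - k)) * a (n - k))"
    unfolding alternating_convolution_def by (rule sum.atLeastAtMost_rev[of _ 0 n, simplified])
  also have "\<dots> = (\<Sum>k=0..n. - ((-1) ^ k * of_nat (n choose k) * a (n - k) * a k))"
  proof (rule sum.cong)
    fix k assume "k \<in> {0..n}"
    then have k: "k \<le> n" by simp
    have "(-1 :: 'a) ^ (n - k) = - ((-1) ^ k)"
      using k assms by (simp add: minus_one_power_iff)
    then show "(-1) ^ (n - k) * of_nat (n choose (n - k)) * a (n - (n - k)) * a (n - k) =
        - ((-1) ^ k * of_nat (n choose k) * a (n - k) * a k)"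
      using k by (simp add: binomial_symmetric[OF k, symmetric])
  qed simp
  also have "\<dots> = - alternating_convolution a a n"
    by (simp add: alternating_convolution_def sum_negf)
  finally have "2 * alternating_convolution a a n = 0"
    by (simp add: eq_neg_iff_add_eq_0 flip: mult_2)
  then show ?thesis by simp
qed

theorem theorem1:
  fixes p q :: "nat \<Rightarrow> 'a::real_normed_field poly"
  assumes "appell_sequence p" and "appell_sequence q"
  shows "\<exists>c :: nat \<Rightarrow> 'a.
           (\<forall>n x. (\<Sum>k=0..n. (-1) ^ k * of_nat (n choose k) * poly (p (n - k)) x * poly (q k) x) = c n) \<and>
           ((\<forall>n. p n = q n) \<longrightarrow> (\<forall>n. odd n \<longrightarrow> c n = 0))"
proof -
  define c where "c = (\<lambda>n. poly (alternating_convolution p q n) 0)"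
  have "poly (alternating_convolution p q n) x = c n" for n x
  proof -
    have "degree (alternating_convolution p q n) = 0"
      using pderiv_alternating_convolution[OF assms] by (simp add: pderiv_eq_0_iff)
    then obtain a where "alternating_convolution p q n = [:a:]"
      by (rule degree_eq_zeroE)
    then show ?thesis by (simp add: c_def)
  qed
  moreover have "c n = 0" if "\<forall>n. p n = q n" "odd n" for n
  proof -
    have "p = q" using that(1) by blast
    then show ?thesis by (simp add: c_def alternating_convolution_self_odd[OF that(2)])
  qed
  ultimately show ?thesis
    by (intro exI[of _ c]) (simp add: poly_alternating_convolution)
qed

end
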